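(* Let $G$ be a connected undirected graph on $N\ge 2$ nodes with positive link weights, and let $\mathcal{S}$ and $\mathcal{S}^{+}$ be its original and inverse simplices in $\mathbb{R}^{N-1}$. Let $\mathcal{V}_1,\mathcal{V}_2$ be non-empty proper subsets of $\mathcal{N}=\{1,\dots,N\}$ with $V_1$ and $V_2$ elements respectively. Then the centroid vectors $c_{\mathcal{V}_1},c_{\mathcal{V}_2}$ of the corresponding faces of $\mathcal{S}$ satisfy $$c_{\mathcal{V}_1}^Tc_{\mathcal{V}_2}=-\frac{\vert\partial\mathcal{V}_1\cap\partial\mathcal{V}_2\vert}{V_1V_2},$$ and the altitudes $a^{+}_{\mathcal{V}_1},a^{+}_{\mathcal{V}_2}$ of the inverse simplex $\mathcal{S}^{+}$ determined by $\mathcal{V}_1$ and $\mathcal{V}_2$ satisfy $$a^{+T}_{\mathcal{V}_1}a^{+}_{\mathcal{V}_2}=-\frac{\vert\partial\mathcal{V}_1\cap\partial\mathcal{V}_2\vert}{\vert\partial\mathcal{V}_1\vert\,\vert\partial\mathcal{V}_2\vert},$$ where $$\partial\mathcal{V}_1\cap\partial\mathcal{V}_2=\{(i,j)\in\mathcal{L} \mid i\in\mathcal{V}_1\text{ and }j\in\mathcal{V}_2\}.$$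
   Context: The graph $G$ has node set $\mathcal{N}=\{1,\dots,N\}$, link set $\mathcal{L}$ (links join distinct nodes) and weights $w_{ij}=w_{ji}>0$ for $(i,j)\in\mathcal{L}$ (all equal to $1$ in the unweighted case). The Laplacian $Q$ is the $N\times N$ symmetric matrix with $(Q)_{ii}=d_i$, the sum of the weights of links incident to $i$, $(Q)_{ij}=-w_{ij}$ if $(i,j)\in\mathcal{L}$, and $(Q)_{ij}=0$ otherwise. Since $G$ is connected, $Q$ has eigenvalues $\mu_1\ge\dots\ge\mu_{N-1}>\mu_N=0$ with orthonormal eigenvectors $z_1,\dots,z_N$; fix such an eigenbasis. The original simplex $\mathcal{S}$ of $G$ is the convex hull of the vertices $s_1,\dots,s_N\in\mathbb{R}^{N-1}$ with $(s_i)_k=(z_k)_i\sqrt{\mu_k}$, and the inverse simplex $\mathcal{S}^{+}$ is the convex hull of the vertices $s^{+}_1,\dots,s^{+}_N\in\mathbb{R}^{N-1}$ with $(s^{+}_i)_k=(z_k)_i/\sqrt{\mu_k}$, $k=1,\dots,N-1$. For $\emptyset\ne\mathcal{V}\subsetneq\mathcal{N}$ with $V$ elements, write $\bar{\mathcal{V}}=\mathcal{N}\setminus\mathcal{V}$. The centroid vector of the face of $\mathcal{S}$ with vertices $\{s_i\}_{i\in\mathcal{V}}$ is $c_{\mathcal{V}}=\frac1V\sum_{i\in\mathcal{V}}s_i$. The face $\mathcal{F}^{+}_{\mathcal{V}}$ of $\mathcal{S}^{+}$ is the convex hull of $\{s^{+}_i\}_{i\in\mathcal{V}}$. The altitude $a^{+}_{\mathcal{V}}$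 of $\mathcal{S}^{+}$ is the vector $a^{+}_{\mathcal{V}}=p^{\star}-q^{\star}$ with $p^{\star}\in\mathcal{F}^{+}_{\bar{\mathcal{V}}}$ and $q^{\star}\in\mathcal{F}^{+}_{\mathcal{V}}$ which is orthogonal to both faces, i.e. orthogonal to $p-p'$ for all $p,p'\in\mathcal{F}^{+}_{\mathcal{V}}$ and for all $p,p'\in\mathcal{F}^{+}_{\bar{\mathcal{V}}}$. The cut set $\partial\mathcal{V}$ is the set of links $(i,j)\in\mathcal{L}$ with $i\in\mathcal{V}$ and $j\in\bar{\mathcal{V}}$. For a set of links, $\vert\cdot\vert$ denotes the number of its links (or, for weighted graphs, the sum of their weights).
   Formalization: The sets V_1 and V_2 are additionally assumed disjoint; for overlapping sets the statement fails (V_1=V_2 makes the left sides positive), and the description of the intersection of the cut sets holds only for disjoint sets. *)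

theory Defs
  imports "HOL-Analysis.Analysis"
begin

text \<open>
  The nodes are the elements of a finite type \<open>'n\<close>, so that \<open>N = CARD('n)\<close>. A link is an unordered
  pair, represented by the two-element set \<open>{i, j}\<close>, and the weight \<open>w\<^sub>i\<^sub>j = w\<^sub>j\<^sub>i\<close> is \<open>w {i, j}\<close>. The
  quantity \<open>|E|\<close> of a set of links is thus \<open>sum w E\<close>; this is \<open>card E\<close> if all weights are 1.
\<close>

definition weighted_graph :: "'n::finite set set \<Rightarrow> ('n set \<Rightarrow> real) \<Rightarrow> bool" where
  "weighted_graph L w \<longleftrightarrow> (\<forall>l\<in>L. card l = 2 \<and> 0 < w l)"

definition connected_graph :: "'n::finite set set \<Rightarrow> bool" where
  "connected_graph L \<longleftrightarrow> (\<forall>i j. (i, j) \<in> {(a, b). {a, b} \<in> L}\<^sup>*)"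

definition laplacian :: "'n::finite set set \<Rightarrow> ('n set \<Rightarrow> real) \<Rightarrow> real^'n^'n" where
  "laplacian L w = (\<chi> i j. if i = j then \<Sum>l | l \<in> L \<and> i \<in> l. w l
                           else if {i, j} \<in> L then - w {i, j} else 0)"

text \<open>
  For a connected graph, \<open>\<mu> (N - 1) > \<mu> N = 0\<close> is a consequence and not part of the definition.
\<close>

definition ordered_eigenbasis :: "real^'n^'n::finite \<Rightarrow> (nat \<Rightarrow> real) \<Rightarrow> (nat \<Rightarrow> real^'n) \<Rightarrow> bool" where
  "ordered_eigenbasis Q \<mu> z \<longleftrightarrow>
     (\<forall>k\<in>{1..CARD('n)}. Q *v z k = \<mu> k *\<^sub>R z k) \<and>
     (\<forall>k\<in>{1..CARD('n)}. \<forall>l\<in>{1..CARD('n)}. z k \<bullet> z l = (if k = l then 1 else 0)) \<and>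
     (\<forall>k\<in>{1..CARD('n)}. \<forall>l\<in>{1..CARD('n)}. k \<le> l \<longrightarrow> \<mu> l \<le> \<mu> k)"

text \<open>
  The space \<open>\<real>\<^bsup>N-1\<^esup>\<close> is \<open>real^'m\<close>, with a bijection \<open>e\<close> from \<open>'m\<close> to \<open>{1..N-1}\<close> numbering the
  coordinates; its existence forces \<open>CARD('m) = N - 1\<close>.
\<close>

definition simplex_vertex ::
  "('m::finite \<Rightarrow> nat) \<Rightarrow> (nat \<Rightarrow> real) \<Rightarrow> (nat \<Rightarrow> real^'n::finite) \<Rightarrow> 'n \<Rightarrow> real^'m" where
  "simplex_vertex e \<mu> z i = (\<chi> k. (z (e k) $ i) * sqrt (\<mu> (e k)))"

definition inverse_simplex_vertex ::
  "('m::finite \<Rightarrow> nat) \<Rightarrow> (nat \<Rightarrow> real) \<Rightarrow> (nat \<Rightarrow> real^'n::finite) \<Rightarrow> 'n \<Rightarrow> real^'m" where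
  "inverse_simplex_vertex e \<mu> z i = (\<chi> k. (z (e k) $ i) / sqrt (\<mu> (e k)))"

text \<open>
  The following three notions are relative to a family \<open>s\<close> of vertices; the whole simplex is
  \<open>face s UNIV\<close>.
\<close>

definition face :: "('n::finite \<Rightarrow> real^'m::finite) \<Rightarrow> 'n set \<Rightarrow> (real^'m) set" where
  "face s V = convex hull (s ` V)"

definition centroid_vector :: "('n::finite \<Rightarrow> real^'m::finite) \<Rightarrow> 'n set \<Rightarrow> real^'m" where
  "centroid_vector s V = (1 / real (card V)) *\<^sub>R (\<Sum>i\<in>V. s i)"

definition is_altitude :: "('n::finite \<Rightarrow> real^'m::finite) \<Rightarrow> 'n set \<Rightarrow> real^'m \<Rightarrow> bool" where
  "is_altitude s V a \<longleftrightarrow>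
     (\<exists>p\<in>face s (- V). \<exists>q\<in>face s V. a = p - q) \<and>
     (\<forall>p\<in>face s V. \<forall>p'\<in>face s V. orthogonal a (p - p')) \<and>
     (\<forall>p\<in>face s (- V). \<forall>p'\<in>face s (- V). orthogonal a (p - p'))"

definition altitude :: "('n::finite \<Rightarrow> real^'m::finite) \<Rightarrow> 'n set \<Rightarrow> real^'m" where
  "altitude s V = (THE a. is_altitude s V a)"

definition cut_set :: "'n::finite set set \<Rightarrow> 'n set \<Rightarrow> 'n set set" where
  "cut_set L V = {{i, j} | i j. {i, j} \<in> L \<and> i \<in> V \<and> j \<in> - V}"

lemma doubleton_in_cut_set_iff:
  "{i, j} \<in> cut_set L V \<longleftrightarrow> {i, j} \<in> L \<and> (i \<in> V \<longleftrightarrow> j \<notin> V)"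
proof
  assume "{i, j} \<in> cut_set L V"
  then show "{i, j} \<in> L \<and> (i \<in> V \<longleftrightarrow> j \<notin> V)"
    unfolding cut_set_def by (auto simp: doubleton_eq_iff insert_commute)
next
  assume *: "{i, j} \<in> L \<and> (i \<in> V \<longleftrightarrow> j \<notin> V)"
  show "{i, j} \<in> cut_set L V"
  proof (cases "i \<in> V")
    case True
    then show ?thesis using * unfolding cut_set_def mem_Collect_eq
      by (intro exI[of _ i] exI[of _ j]) simp
  next
    case False
    then show ?thesis using * unfolding cut_set_def mem_Collect_eq
      by (intro exI[of _ j] exI[of _ i]) (simp add: insert_commute)
  qed
qed

lemma doubleton_in_links_between_iff:
  "{i, j} \<in> {{a, b} | a b. {a, b} \<in> L \<and> a \<in> V\<^sub>1 \<and> b \<in> V\<^sub>2} \<longleftrightarrow>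
     {i, j} \<in> L \<and> (i \<in> V\<^sub>1 \<and> j \<in> V\<^sub>2 \<or> j \<in> V\<^sub>1 \<and> i \<in> V\<^sub>2)" (is "?l \<longleftrightarrow> ?r")
proof
  assume ?l
  then show ?r by (auto simp: doubleton_eq_iff insert_commute)
next
  assume *: ?r
  show ?l
  proof (cases "i \<in> V\<^sub>1 \<and> j \<in> V\<^sub>2")
    case True
    then show ?thesis using * unfolding mem_Collect_eq
      by (intro exI[of _ i] exI[of _ j]) simp
  next
    case False
    then show ?thesis using * unfolding mem_Collect_eq
      by (intro exI[of _ j] exI[of _ i]) (auto simp: insert_commute)
  qed
qed

text \<open>
  In a connected graph, the common links of two cut sets are the links joining \<open>V\<^sub>1\<close> to \<open>V\<^sub>2\<close> exactly
  when \<open>V\<^sub>1\<close> and \<open>V\<^sub>2\<close> are disjoint. Describing \<open>\<partial>V\<^sub>1 \<inter> \<partial>V\<^sub>2\<close> in this way therefore presupposes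
  disjointness, and the inner product formulas do too: for \<open>V\<^sub>1 = V\<^sub>2\<close> their left-hand sides are
  positive squared norms.
\<close>

lemma cut_set_Int_eq_iff_disjoint:
  fixes L :: "'n::finite set set"
  assumes conn: "connected_graph L" and "V\<^sub>1 \<noteq> UNIV"
  shows "cut_set L V\<^sub>1 \<inter> cut_set L V\<^sub>2 = {{i, j} | i j. {i, j} \<in> L \<and> i \<in> V\<^sub>1 \<and> j \<in> V\<^sub>2}
         \<longleftrightarrow> V\<^sub>1 \<inter> V\<^sub>2 = {}"
    (is "?C = ?B \<longleftrightarrow> _")
proof
  assume eq: "?C = ?B"
  have closed: "j \<in> V\<^sub>1 \<inter> V\<^sub>2" if i: "i \<in> V\<^sub>1 \<inter> V\<^sub>2" and l: "{i, j} \<in> L" for i j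
  proof -
    have "{i, j} \<in> ?C \<longleftrightarrow> {i, j} \<in> ?B" by (simp only: eq)
    then show ?thesis
      unfolding Int_iff doubleton_in_cut_set_iff doubleton_in_links_between_iff
      using i l by auto
  qed
  show "V\<^sub>1 \<inter> V\<^sub>2 = {}"
  proof (rule ccontr)
    assume "V\<^sub>1 \<inter> V\<^sub>2 \<noteq> {}"
    then obtain i where i: "i \<in> V\<^sub>1 \<inter> V\<^sub>2" by blast
    have "j \<in> V\<^sub>1 \<inter> V\<^sub>2" for j
    proof -
      have "(i, j) \<in> {(a, b). {a, b} \<in> L}\<^sup>*" using conn by (simp add: connected_graph_def)
      then show ?thesis
      proof (induction rule: rtrancl_induct)
        case base
        show ?case by (rule i)
      next
        case (step a b)
        then show ?case using closed[of a b] by simp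
      qed
    qed
    with \<open>V\<^sub>1 \<noteq> UNIV\<close> show False by blast
  qed
next
  assume disj: "V\<^sub>1 \<inter> V\<^sub>2 = {}"
  have iff: "{i, j} \<in> ?C \<longleftrightarrow> {i, j} \<in> ?B" for i j
    unfolding Int_iff doubleton_in_cut_set_iff doubleton_in_links_between_iff
    using disj by auto
  show "?C = ?B"
  proof
    show "?C \<subseteq> ?B"
    proof
      fix l assume l: "l \<in> ?C"
      then obtain i j where ij: "l = {i, j}" unfolding cut_set_def by blast
      show "l \<in> ?B" using l unfolding ij iff .
    qed
    show "?B \<subseteq> ?C"
    proof
      fix l assume l: "l \<in> ?B"
      then obtain i j where ij: "l = {i, j}" by blast
      show "l \<in> ?C" using l unfolding ij iff .
    qed
  qed
qed

end

theory Submission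
  imports Defs
begin

text \<open>
  The vertex families are dual to each other: \<open>s\<^sub>i \<bullet> s\<^sub>j = Q\<^sub>i\<^sub>j\<close>, \<open>s\<^sub>i = \<Sum>\<^sub>j Q\<^sub>i\<^sub>j s\<^sup>+\<^sub>j\<close> and
  \<open>s\<^sub>i \<bullet> s\<^sup>+\<^sub>j = \<delta>\<^sub>i\<^sub>j - 1/N\<close>. By the last identity \<open>\<Sum>\<^sub>i\<^sub>\<in>\<^sub>V s\<^sub>i\<close> is orthogonal to the two
  complementary faces of the inverse simplex. By the second one its multiple by \<open>-1/|\<partial>V|\<close> is the
  difference of two affine combinations of the \<open>s\<^sup>+\<^sub>j\<close>, over the complement of \<open>V\<close> and over \<open>V\<close>;
  these are convex because off-diagonal entries of \<open>Q\<close> are non-positive. So that multiple is the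
  altitude, and both inner product formulas follow from the first identity.
\<close>

section \<open>The weighted adjacency matrix and sums over sets of links\<close>

definition link_weight :: "'n::finite set set \<Rightarrow> ('n set \<Rightarrow> real) \<Rightarrow> 'n \<Rightarrow> 'n \<Rightarrow> real" where
  "link_weight L w i j = (if {i, j} \<in> L then w {i, j} else 0)"

lemma link_weight_commute: "link_weight L w i j = link_weight L w j i"
  by (simp add: link_weight_def insert_commute)

lemma link_weight_nonneg: "weighted_graph L w \<Longrightarrow> 0 \<le> link_weight L w i j"
  by (auto simp: link_weight_def weighted_graph_def less_imp_le)

lemma link_weight_self: "weighted_graph L w \<Longrightarrow> link_weight L w i i = 0"
  by (force simp: link_weight_def weighted_graph_def)

text \<open>Disjointness makes \<open>(i, j) \<mapsto> {i, j}\<close> injective on pairs from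
  \<open>A \<times> B\<close>, so every unordered link is counted exactly once.\<close>

lemma sum_links_between:
  fixes L :: "'n::finite set set"
  assumes "A \<inter> B = {}"
  shows "sum w {{i, j} | i j. {i, j} \<in> L \<and> i \<in> A \<and> j \<in> B}
         = (\<Sum>i\<in>A. \<Sum>j\<in>B. link_weight L w i j)"
proof -
  let ?P = "{(i, j). {i, j} \<in> L \<and> i \<in> A \<and> j \<in> B}"
  have "inj_on (\<lambda>(i, j). {i, j}) ?P"
    using assms by (auto simp: inj_on_def doubleton_eq_iff)
  moreover have "{{i, j} | i j. {i, j} \<in> L \<and> i \<in> A \<and> j \<in> B} = (\<lambda>(i, j). {i, j}) ` ?P"
    by auto
  ultimately have "sum w {{i, j} | i j. {i, j} \<in> L \<and> i \<in> A \<and> j \<in> B}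
      = (\<Sum>(i, j)\<in>?P. w {i, j})"
    by (simp add: sum.reindex case_prod_unfold)
  also have "\<dots> = (\<Sum>(i, j)\<in>A \<times> B. link_weight L w i j)"
    by (rule sum.mono_neutral_cong_left) (auto simp: link_weight_def split: if_splits)
  finally show ?thesis
    by (simp add: sum.cartesian_product)
qed

lemma sum_cut_set:
  "sum w (cut_set L V) = (\<Sum>i\<in>V. \<Sum>j\<in>-V. link_weight L w i j)"
  unfolding cut_set_def by (rule sum_links_between) simp

text \<open>A link has two distinct nodes, so the links at \<open>i\<close> are those between
  \<open>{i}\<close> and its complement. The diagonal term added at the end is zero.\<close>

lemma sum_incident_links:
  assumes "weighted_graph L w"
  shows "(\<Sum>l | l \<in> L \<and> i \<in> l. w l) = (\<Sum>j\<in>UNIV. link_weight L w i j)"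
proof -
  have "{l. l \<in> L \<and> i \<in> l} = {{a, j} | a j. {a, j} \<in> L \<and> a \<in> {i} \<and> j \<in> - {i}}"
  proof (intro subset_antisym subsetI)
    fix l assume l: "l \<in> {l. l \<in> L \<and> i \<in> l}"
    then have "card l = 2" using assms by (simp add: weighted_graph_def)
    then obtain a b where ab: "l = {a, b}" "a \<noteq> b" by (auto simp: card_2_iff)
    show "l \<in> {{a, j} | a j. {a, j} \<in> L \<and> a \<in> {i} \<and> j \<in> - {i}}"
    proof (cases "i = a")
      case True
      then show ?thesis using l ab by blast
    next
      case False
      then have "i = b" using l ab by auto
      then show ?thesis using l ab by (auto simp: insert_commute)
    qed
  qed auto
  then have "(\<Sum>l | l \<in> L \<and> i \<in> l. w l) = (\<Sum>j\<in>-{i}. link_weight L w i j)"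
    using sum_links_between[of "{i}" "-{i}" w L] by simp
  also have "\<dots> = (\<Sum>j\<in>UNIV. link_weight L w i j)"
    by (rule sum.mono_neutral_left) (auto simp: link_weight_self[OF assms])
  finally show ?thesis .
qed

section \<open>The Laplacian: quadratic form, kernel and connectivity\<close>

lemma laplacian_nth:
  assumes "weighted_graph L w"
  shows "laplacian L w $ i $ j
    = (if i = j then \<Sum>k\<in>UNIV. link_weight L w i k else 0) - link_weight L w i j"
proof (cases "i = j")
  case True
  then show ?thesis
    by (simp add: laplacian_def sum_incident_links[OF assms] link_weight_self[OF assms])
qed (simp add: laplacian_def link_weight_def)

lemma laplacian_nth_commute: "laplacian L w $ i $ j = laplacian L w $ j $ i"
  by (simp add: laplacian_def insert_commute)

lemma laplacian_mult_nth:
  assumes "weighted_graph L w"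
  shows "(laplacian L w *v x) $ i = (\<Sum>j\<in>UNIV. link_weight L w i j * (x $ i - x $ j))"
proof -
  have "(laplacian L w *v x) $ i
      = (\<Sum>j\<in>UNIV. (if i = j then (\<Sum>k\<in>UNIV. link_weight L w i k) * x $ j else 0)
          - link_weight L w i j * x $ j)"
    unfolding matrix_vector_mult_def by (auto simp: laplacian_nth[OF assms] algebra_simps intro!: sum.cong)
  also have "\<dots> = (\<Sum>j\<in>UNIV. link_weight L w i j) * x $ i - (\<Sum>j\<in>UNIV. link_weight L w i j * x $ j)"
    by (simp add: sum_subtractf)
  finally show ?thesis
    by (simp add: sum_subtractf sum_distrib_right right_diff_distrib)
qed

text \<open>Exchanging the two summation indices gives a second expression for the same form, by
  symmetry of the weights; adding both completes the square. The factor 2 reflects that ordered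
  pairs meet each link twice.\<close>

lemma inner_laplacian_mult:
  assumes "weighted_graph L w"
  shows "2 * (x \<bullet> (laplacian L w *v x))
    = (\<Sum>i\<in>UNIV. \<Sum>j\<in>UNIV. link_weight L w i j * (x $ i - x $ j)\<^sup>2)"
proof -
  let ?a = "link_weight L w"
  have 1: "x \<bullet> (laplacian L w *v x) = (\<Sum>i\<in>UNIV. \<Sum>j\<in>UNIV. ?a i j * (x $ i - x $ j) * x $ i)"
    by (simp add: inner_vec_def laplacian_mult_nth[OF assms] sum_distrib_left mult_ac)
  also have "\<dots> = (\<Sum>i\<in>UNIV. \<Sum>j\<in>UNIV. ?a j i * (x $ j - x $ i) * x $ j)"
    by (rule sum.swap)
  also have "\<dots> = (\<Sum>i\<in>UNIV. \<Sum>j\<in>UNIV. - (?a i j * (x $ i - x $ j) * x $ j))"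
    by (intro sum.cong refl) (subst link_weight_commute, simp add: algebra_simps)
  finally have "2 * (x \<bullet> (laplacian L w *v x))
      = (\<Sum>i\<in>UNIV. \<Sum>j\<in>UNIV. ?a i j * (x $ i - x $ j) * x $ i)
        + (\<Sum>i\<in>UNIV. \<Sum>j\<in>UNIV. - (?a i j * (x $ i - x $ j) * x $ j))"
    using 1 by simp
  also have "\<dots> = (\<Sum>i\<in>UNIV. \<Sum>j\<in>UNIV. ?a i j * (x $ i - x $ j)\<^sup>2)"
    unfolding sum.distrib[symmetric]
    by (intro sum.cong refl) (simp add: power2_eq_square algebra_simps)
  finally show ?thesis .
qed

lemma connected_graph_induct:
  assumes "connected_graph L" and "P i" and "\<And>a b. {a, b} \<in> L \<Longrightarrow> P a \<Longrightarrow> P b"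
  shows "P j"
proof -
  have "(i, j) \<in> {(a, b). {a, b} \<in> L}\<^sup>*"
    using assms(1) by (simp add: connected_graph_def)
  then show ?thesis
  proof (induction rule: rtrancl_induct)
    case base
    show ?case by (rule assms(2))
  next
    case (step a b)
    then show ?case using assms(3)[of a b] by simp
  qed
qed

text \<open>The quadratic form vanishes at \<open>x\<close> and its terms are non-negative, so each
  is zero. Hence \<open>x\<close> agrees at the two ends of every link, and connectivity spreads
  this to all nodes.\<close>

lemma laplacian_kernel_constant:
  assumes wg: "weighted_graph L w" and conn: "connected_graph L" and ker: "laplacian L w *v x = 0"
  shows "x $ i = x $ j"
proof -
  have "(\<Sum>i\<in>UNIV. \<Sum>j\<in>UNIV. link_weight L w i j * (x $ i - x $ j)\<^sup>2) = 0"
    using inner_laplacian_mult[OF wg, of x] ker by simp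
  then have 0: "link_weight L w a b * (x $ a - x $ b)\<^sup>2 = 0" for a b
    by (simp add: sum_nonneg_eq_0_iff sum_nonneg link_weight_nonneg[OF wg])
  have step: "x $ i = x $ b" if "{a, b} \<in> L" "x $ i = x $ a" for a b
    using 0[of a b] wg that by (force simp: link_weight_def weighted_graph_def)
  show ?thesis
    by (rule connected_graph_induct[OF conn, of "\<lambda>j. x $ i = x $ j" i, OF refl step])
qed

text \<open>If no link left \<open>V\<close>, then \<open>V\<close> would be closed under adjacency
  and, by connectivity, contain all nodes. Positivity makes it possible to divide by the
  cut.\<close>

lemma sum_cut_set_pos:
  assumes wg: "weighted_graph L w" and conn: "connected_graph L" and "V \<noteq> {}" and "V \<noteq> UNIV"
  shows "0 < sum w (cut_set L V)"
proof (rule sum_pos)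
  show "0 < w l" if "l \<in> cut_set L V" for l
    using that wg by (auto simp: cut_set_def weighted_graph_def)
  show "cut_set L V \<noteq> {}"
  proof
    assume empty: "cut_set L V = {}"
    have closed: "b \<in> V" if "{a, b} \<in> L" "a \<in> V" for a b
      using that empty doubleton_in_cut_set_iff[of a b L V] by auto
    obtain i where "i \<in> V" using \<open>V \<noteq> {}\<close> by blast
    then have "j \<in> V" for j
      by (rule connected_graph_induct[OF conn]) (rule closed)
    with \<open>V \<noteq> UNIV\<close> show False by blast
  qed
qed simp

section \<open>General facts on orthonormal bases, altitudes and convex hulls\<close>

lemma orthonormal_completeness:
  fixes z :: "nat \<Rightarrow> real^'n::finite"
  assumes orth: "\<forall>k\<in>{1..CARD('n)}. \<forall>l\<in>{1..CARD('n)}. z k \<bullet> z l = (if k = l then 1 else 0)"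
  shows "(\<Sum>k\<in>{1..CARD('n)}. z k $ i * z k $ j) = (if i = j then 1 else 0)"
proof -
  \<comment> \<open>Numbering the basis vectors by nodes makes them the rows of a square matrix. For
    such a matrix, orthonormal rows imply orthonormal columns.\<close>
  obtain f :: "'n \<Rightarrow> nat" where f: "bij_betw f UNIV {1..CARD('n)}"
    using finite_same_card_bij[of "UNIV :: 'n set" "{1..CARD('n)}"] by auto
  then have mem: "f a \<in> {1..CARD('n)}" for a
    by (auto simp: bij_betw_def)
  have inj: "f a = f b \<longleftrightarrow> a = b" for a b
    using f by (auto simp: bij_betw_def inj_on_def)
  define A :: "real^'n^'n" where "A = (\<chi> a j. z (f a) $ j)"
  have "A ** transpose A = mat 1"
    using orth mem inj
    by (auto simp: vec_eq_iff matrix_matrix_mult_def transpose_def mat_def A_def inner_vec_def)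
  then have "transpose A ** A = mat 1"
    by (simp add: matrix_left_right_inverse)
  then have "(transpose A ** A) $ i $ j = mat 1 $ i $ j"
    by simp
  then have "(\<Sum>a\<in>UNIV. z (f a) $ i * z (f a) $ j) = (if i = j then 1 else 0)"
    by (simp add: matrix_matrix_mult_def transpose_def mat_def A_def)
  then show ?thesis
    using sum.reindex_bij_betw[OF f, of "\<lambda>k. z k $ i * z k $ j"] by simp
qed

text \<open>The difference of two altitudes is a combination of a direction in each face. Both
  altitudes are orthogonal to these directions, so their difference is orthogonal to itself. This
  justifies the \<open>THE\<close> in \<open>altitude\<close>.\<close>

lemma is_altitude_unique:
  assumes a: "is_altitude s V a" and b: "is_altitude s V b"
  shows "a = b"
proof -
  obtain p q where p: "p \<in> face s (- V)" and q: "q \<in> face s V" and apq: "a = p - q"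
    using a by (auto simp: is_altitude_def)
  obtain p' q' where p': "p' \<in> face s (- V)" and q': "q' \<in> face s V" and bpq: "b = p' - q'"
    using b by (auto simp: is_altitude_def)
  have ab: "a - b = (p - p') - (q - q')"
    by (simp add: apq bpq)
  have "a \<bullet> (p - p') = 0" "a \<bullet> (q - q') = 0" "b \<bullet> (p - p') = 0" "b \<bullet> (q - q') = 0"
    using a b p p' q q' unfolding is_altitude_def orthogonal_def by blast+
  then have "(a - b) \<bullet> (a - b) = 0"
    unfolding ab[THEN arg_cong, of "\<lambda>v. (a - b) \<bullet> v"]
    by (simp add: inner_diff_left inner_diff_right)
  then show ?thesis by simp
qed

lemma altitude_eqI: "is_altitude s V a \<Longrightarrow> altitude s V = a"
  unfolding altitude_def using is_altitude_unique by (intro the_equality)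

text \<open>The generators lie in one hyperplane with normal vector \<open>a\<close>; being convex,
  it contains their hull. Orthogonality to a face thus reduces to its vertices.\<close>

lemma orthogonal_convex_hullI:
  assumes gen: "\<And>x y. x \<in> S \<Longrightarrow> y \<in> S \<Longrightarrow> orthogonal a (x - y)"
    and p: "p \<in> convex hull S" and q: "q \<in> convex hull S"
  shows "orthogonal a (p - q)"
proof -
  obtain y where y: "y \<in> S"
    using p by fastforce
  have "convex {v. a \<bullet> v = a \<bullet> y}"
    by (rule convex_hyperplane)
  moreover have "S \<subseteq> {v. a \<bullet> v = a \<bullet> y}"
    using gen[OF _ y] by (auto simp: orthogonal_def inner_diff_right)
  ultimately have "convex hull S \<subseteq> {v. a \<bullet> v = a \<bullet> y}"
    by (rule hull_minimal[rotated])
  then have "a \<bullet> p = a \<bullet> y" "a \<bullet> q = a \<bullet> y"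
    using p q by auto
  then show ?thesis
    by (simp add: orthogonal_def inner_diff_right)
qed

section \<open>A connected weighted graph with a fixed Laplacian eigenbasis\<close>

locale graph_eigenbasis =
  fixes L :: "'n::finite set set" and w :: "'n set \<Rightarrow> real"
    and \<mu> :: "nat \<Rightarrow> real" and z :: "nat \<Rightarrow> real^'n"
    and e :: "'m::finite \<Rightarrow> nat"
  assumes weighted: "weighted_graph L w" and connected: "connected_graph L"
    and eigenbasis: "ordered_eigenbasis (laplacian L w) \<mu> z"
    and numbering: "bij_betw e (UNIV :: 'm set) {1..CARD('n) - 1}"
begin

abbreviation "s \<equiv> simplex_vertex e \<mu> z"
abbreviation "s_inv \<equiv> inverse_simplex_vertex e \<mu> z"

lemma card_mem: "CARD('n) \<in> {1..CARD('n)}"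
  by (simp add: Suc_leI)

lemma eigenvector: "k \<in> {1..CARD('n)} \<Longrightarrow> laplacian L w *v z k = \<mu> k *\<^sub>R z k"
  using eigenbasis by (simp add: ordered_eigenbasis_def)

lemma orthonormal: "k \<in> {1..CARD('n)} \<Longrightarrow> l \<in> {1..CARD('n)} \<Longrightarrow> z k \<bullet> z l = (if k = l then 1 else 0)"
  using eigenbasis unfolding ordered_eigenbasis_def by blast

lemma eigenvalue_antimono: "k \<in> {1..CARD('n)} \<Longrightarrow> l \<in> {1..CARD('n)} \<Longrightarrow> k \<le> l \<Longrightarrow> \<mu> l \<le> \<mu> k"
  using eigenbasis unfolding ordered_eigenbasis_def by blast

lemma completeness: "(\<Sum>k\<in>{1..CARD('n)}. z k $ i * z k $ j) = (if i = j then 1 else 0)"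
  using eigenbasis orthonormal_completeness unfolding ordered_eigenbasis_def by blast

section \<open>The spectrum of the Laplacian\<close>

lemma eigenvalue_nonneg:
  assumes "k \<in> {1..CARD('n)}"
  shows "0 \<le> \<mu> k"
proof -
  have "0 \<le> 2 * (z k \<bullet> (laplacian L w *v z k))"
    unfolding inner_laplacian_mult[OF weighted]
    by (intro sum_nonneg mult_nonneg_nonneg link_weight_nonneg weighted) simp
  then show ?thesis
    using assms by (simp add: eigenvector orthonormal)
qed

text \<open>Summing the eigenvector equation over all coordinates produces column sums of the
  Laplacian. By symmetry these are row sums, the entries of its product with the all-one vector,
  which is zero.\<close>

lemma sum_eigenvector_eq_0:
  assumes "k \<in> {1..CARD('n)}" and "\<mu> k \<noteq> 0"
  shows "(\<Sum>i\<in>UNIV. z k $ i) = 0"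
proof -
  have "\<mu> k * (\<Sum>i\<in>UNIV. z k $ i) = (\<Sum>i\<in>UNIV. (laplacian L w *v z k) $ i)"
    by (simp add: eigenvector[OF assms(1)] sum_distrib_left)
  also have "\<dots> = (\<Sum>i\<in>UNIV. \<Sum>j\<in>UNIV. laplacian L w $ i $ j * z k $ j)"
    by (simp add: matrix_vector_mult_def)
  also have "\<dots> = (\<Sum>j\<in>UNIV. \<Sum>i\<in>UNIV. laplacian L w $ i $ j * z k $ j)"
    by (rule sum.swap)
  also have "\<dots> = (\<Sum>j\<in>UNIV. (laplacian L w *v vec 1) $ j * z k $ j)"
    by (simp add: matrix_vector_mult_def sum_distrib_right laplacian_nth_commute)
  also have "\<dots> = 0"
    by (simp add: laplacian_mult_nth[OF weighted])
  finally show ?thesis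
    using assms(2) by simp
qed

text \<open>Otherwise the ordering would make every eigenvalue non-zero, so every basis vector would
  have coordinate sum zero. Summing the completeness relation over \<open>j\<close> then gives
  \<open>1 = 0\<close>.\<close>

lemma last_eigenvalue: "\<mu> CARD('n) = 0"
proof (rule ccontr)
  assume "\<mu> CARD('n) \<noteq> 0"
  then have "0 < \<mu> CARD('n)"
    using eigenvalue_nonneg[OF card_mem] by simp
  then have nz: "\<mu> k \<noteq> 0" if "k \<in> {1..CARD('n)}" for k
    using eigenvalue_antimono[OF that card_mem] that by simp
  fix i :: 'n
  have "1 = (\<Sum>j\<in>UNIV. \<Sum>k\<in>{1..CARD('n)}. z k $ i * z k $ j)"
    unfolding completeness by simp
  also have "\<dots> = (\<Sum>k\<in>{1..CARD('n)}. \<Sum>j\<in>UNIV. z k $ i * z k $ j)"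
    by (rule sum.swap)
  also have "\<dots> = (\<Sum>k\<in>{1..CARD('n)}. 0)"
    using sum_eigenvector_eq_0[OF _ nz] by (intro sum.cong refl) (simp add: sum_distrib_left[symmetric])
  finally show False by simp
qed

lemma last_eigenvector_constant: "z CARD('n) $ i = z CARD('n) $ j"
  by (rule laplacian_kernel_constant[OF weighted connected])
    (simp add: eigenvector[OF card_mem] last_eigenvalue)

text \<open>A second zero eigenvalue would give a second constant eigenvector, and two constant unit
  vectors cannot be orthogonal.\<close>

lemma eigenvalue_pos:
  assumes k: "k \<in> {1..CARD('n) - 1}"
  shows "0 < \<mu> k"
proof (rule ccontr)
  assume "\<not> 0 < \<mu> k"
  moreover have kN: "k \<in> {1..CARD('n)}" "k \<noteq> CARD('n)"
    using k by (auto simp: le_diff_conv2)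
  ultimately have "\<mu> k = 0"
    using eigenvalue_nonneg[of k] by simp
  then have const: "z k $ i = z k $ j" for i j
    by (intro laplacian_kernel_constant[OF weighted connected]) (simp add: eigenvector[OF kN(1)])
  obtain c d where c: "z k = c *\<^sub>R vec 1" and d: "z CARD('n) = d *\<^sub>R vec 1"
  proof
    fix i :: 'n
    show "z k = z k $ i *\<^sub>R vec 1"
      using const by (simp add: vec_eq_iff)
    show "z CARD('n) = z CARD('n) $ i *\<^sub>R vec 1"
      using last_eigenvector_constant by (simp add: vec_eq_iff)
  qed
  have "z k \<bullet> z CARD('n) = 0" "z k \<bullet> z k = 1" "z CARD('n) \<bullet> z CARD('n) = 1"
    using orthonormal kN card_mem by simp_all
  then show False
    unfolding c d by auto
qed

section \<open>Inner products and duality of the two vertex families\<close>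

lemma sum_coordinates: "(\<Sum>k\<in>UNIV. f (e k)) = (\<Sum>k\<in>{1..CARD('n) - 1}. f k)" for f :: "nat \<Rightarrow> real"
  using sum.reindex_bij_betw[OF numbering] .

lemma sum_split_last: "(\<Sum>k\<in>{1..CARD('n)}. f k) = (\<Sum>k\<in>{1..CARD('n) - 1}. f k) + f CARD('n)" for f :: "nat \<Rightarrow> real"
  using sum.cl_ivl_Suc[of f 1 "CARD('n) - 1"] by simp

lemma coordinate_eigenvalue_pos: "0 < \<mu> (e k)"
  using numbering by (intro eigenvalue_pos) (auto simp: bij_betw_def)

text \<open>This is the spectral decomposition of the Laplacian. The term for \<open>k = N\<close>
  can be added because its eigenvalue is zero; then \<open>\<mu> k * z k\<close> becomes the
  Laplacian applied to \<open>z k\<close>, and completeness collapses the sum.\<close>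

lemma inner_vertices: "s i \<bullet> s j = laplacian L w $ i $ j"
proof -
  have "s i \<bullet> s j = (\<Sum>k\<in>UNIV. \<mu> (e k) * z (e k) $ i * z (e k) $ j)"
    using coordinate_eigenvalue_pos
    by (auto simp: simplex_vertex_def inner_vec_def less_imp_le intro!: sum.cong)
  also have "\<dots> = (\<Sum>k\<in>{1..CARD('n) - 1}. \<mu> k * z k $ i * z k $ j)"
    by (rule sum_coordinates)
  also have "\<dots> = (\<Sum>k\<in>{1..CARD('n)}. \<mu> k * z k $ i * z k $ j)"
    unfolding sum_split_last by (simp add: last_eigenvalue)
  also have "\<dots> = (\<Sum>k\<in>{1..CARD('n)}. (laplacian L w *v z k) $ i * z k $ j)"
    by (intro sum.cong refl) (simp add: eigenvector)
  also have "\<dots> = (\<Sum>k\<in>{1..CARD('n)}. \<Sum>l\<in>UNIV. laplacian L w $ i $ l * (z k $ l * z k $ j))"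
    by (simp add: matrix_vector_mult_def sum_distrib_right mult.assoc)
  also have "\<dots> = (\<Sum>l\<in>UNIV. \<Sum>k\<in>{1..CARD('n)}. laplacian L w $ i $ l * (z k $ l * z k $ j))"
    by (rule sum.swap)
  also have "\<dots> = laplacian L w $ i $ j"
    unfolding sum_distrib_left[symmetric] completeness by (simp add: if_distrib cong: if_cong)
  finally show ?thesis .
qed

text \<open>The square roots cancel, which leaves the completeness relation without its last term.
  What matters later is that this term does not depend on \<open>j\<close>.\<close>

lemma inner_vertex_inverse_vertex:
  "s i \<bullet> s_inv j = (if i = j then 1 else 0) - z CARD('n) $ i * z CARD('n) $ j"
proof -
  have "s i \<bullet> s_inv j = (\<Sum>k\<in>UNIV. z (e k) $ i * z (e k) $ j)"
    using coordinate_eigenvalue_pos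
    by (simp add: simplex_vertex_def inverse_simplex_vertex_def inner_vec_def less_imp_neq[symmetric])
  also have "\<dots> = (\<Sum>k\<in>{1..CARD('n) - 1}. z k $ i * z k $ j)"
    by (rule sum_coordinates)
  finally show ?thesis
    using completeness[of i j] unfolding sum_split_last by linarith
qed

text \<open>In each coordinate this is the eigenvector equation divided by the square root of the
  eigenvalue.\<close>

lemma vertex_eq_sum_inverse_vertices: "s i = (\<Sum>j\<in>UNIV. laplacian L w $ i $ j *\<^sub>R s_inv j)"
proof -
  have "s i $ k = (\<Sum>j\<in>UNIV. laplacian L w $ i $ j * s_inv j $ k)" for k
  proof -
    have ek: "e k \<in> {1..CARD('n)}"
      using bij_betwE[OF numbering] by (meson UNIV_I atLeastAtMost_iff diff_le_self order_trans)
    have "(\<Sum>j\<in>UNIV. laplacian L w $ i $ j * s_inv j $ k)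
        = (laplacian L w *v z (e k)) $ i / sqrt (\<mu> (e k))"
      by (simp add: inverse_simplex_vertex_def matrix_vector_mult_def sum_divide_distrib)
    also have "\<dots> = z (e k) $ i * (\<mu> (e k) / sqrt (\<mu> (e k)))"
      by (simp add: eigenvector[OF ek])
    also have "\<dots> = s i $ k"
      using coordinate_eigenvalue_pos[of k]
      by (simp add: simplex_vertex_def real_div_sqrt)
    finally show ?thesis by simp
  qed
  then show ?thesis
    by (simp add: vec_eq_iff)
qed

section \<open>Altitudes of the inverse simplex and the inner product formulas\<close>

lemma sum_laplacian_column:
  "(\<Sum>i\<in>V. laplacian L w $ i $ j)
   = (if j \<in> V then \<Sum>i\<in>-V. link_weight L w i j else - (\<Sum>i\<in>V. link_weight L w i j))"
proof -
  \<comment> \<open>For \<open>j \<in> V\<close> the diagonal entry is the full degree of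
    \<open>j\<close>; splitting it lets the weights into \<open>V\<close> cancel, so only those
    leaving \<open>V\<close> remain.\<close>
  have "(\<Sum>k\<in>UNIV. link_weight L w j k)
      = (\<Sum>i\<in>V. link_weight L w i j) + (\<Sum>i\<in>-V. link_weight L w i j)"
    using sum.union_disjoint[of V "-V" "\<lambda>i. link_weight L w i j"]
    unfolding link_weight_commute[of L w j] by simp
  then show ?thesis
    by (simp add: laplacian_nth[OF weighted] sum_subtractf)
qed

text \<open>The coefficients change sign between \<open>V\<close> and its complement. Collecting
  them by sign exhibits the sum, up to scaling, as a difference of points in the two opposite
  faces.\<close>

lemma sum_vertices_eq:
  "(\<Sum>i\<in>V. s i) = (\<Sum>j\<in>V. (\<Sum>i\<in>-V. link_weight L w i j) *\<^sub>R s_inv j)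
                 - (\<Sum>j\<in>-V. (\<Sum>i\<in>V. link_weight L w i j) *\<^sub>R s_inv j)"
proof -
  have "(\<Sum>i\<in>V. s i) = (\<Sum>j\<in>UNIV. \<Sum>i\<in>V. laplacian L w $ i $ j *\<^sub>R s_inv j)"
    unfolding vertex_eq_sum_inverse_vertices by (rule sum.swap)
  also have "\<dots> = (\<Sum>j\<in>UNIV. (\<Sum>i\<in>V. laplacian L w $ i $ j) *\<^sub>R s_inv j)"
    by (simp add: scaleR_left.sum)
  also have "\<dots> = (\<Sum>j\<in>V. (\<Sum>i\<in>V. laplacian L w $ i $ j) *\<^sub>R s_inv j)
                 + (\<Sum>j\<in>-V. (\<Sum>i\<in>V. laplacian L w $ i $ j) *\<^sub>R s_inv j)"
    using sum.union_disjoint[of V "-V" "\<lambda>j. (\<Sum>i\<in>V. laplacian L w $ i $ j) *\<^sub>R s_inv j"] by simp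
  finally show ?thesis
    by (simp add: sum_laplacian_column sum_negf)
qed

lemma altitude_inverse_simplex:
  assumes "V \<noteq> {}" and "V \<noteq> UNIV"
  shows "altitude s_inv V = - (1 / sum w (cut_set L V)) *\<^sub>R (\<Sum>i\<in>V. s i)"
proof (rule altitude_eqI)
  define c where "c = sum w (cut_set L V)"
  have c: "0 < c"
    unfolding c_def using sum_cut_set_pos[OF weighted connected assms] .
  define a where "a = - (1 / c) *\<^sub>R (\<Sum>i\<in>V. s i)"
  \<comment> \<open>For \<open>j\<close> outside \<open>A\<close>, this is the fraction of the cut
    weight carried by the links from \<open>j\<close> to \<open>A\<close>; these fractions are the
    convex coefficients of \<open>p\<close> and \<open>q\<close>.\<close>
  define b where "b A j = (\<Sum>i\<in>A. link_weight L w i j) / c" for A j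
  define p where "p = (\<Sum>j\<in>-V. b V j *\<^sub>R s_inv j)"
  define q where "q = (\<Sum>j\<in>V. b (-V) j *\<^sub>R s_inv j)"
  have b_nonneg: "0 \<le> b A j" for A j
    unfolding b_def using c by (intro divide_nonneg_pos sum_nonneg link_weight_nonneg weighted)
  \<comment> \<open>Seen from either side, the weights add up to the whole cut, so both families of
    coefficients sum to 1.\<close>
  have c1: "(\<Sum>j\<in>-V. \<Sum>i\<in>V. link_weight L w i j) = c"
    unfolding c_def sum_cut_set by (rule sum.swap)
  have c2: "(\<Sum>j\<in>V. \<Sum>i\<in>-V. link_weight L w i j) = c"
    unfolding c_def sum_cut_set by (simp add: link_weight_commute)
  have p: "p \<in> face s_inv (-V)"
    unfolding p_def face_def using b_nonneg c c1
    by (intro convex_sum convex_convex_hull) (auto simp: b_def sum_divide_distrib[symmetric] hull_inc)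
  have q: "q \<in> face s_inv V"
    unfolding q_def face_def using b_nonneg c c2
    by (intro convex_sum convex_convex_hull) (auto simp: b_def sum_divide_distrib[symmetric] hull_inc)
  have apq: "a = p - q"
    unfolding a_def p_def q_def b_def sum_vertices_eq
    by (simp add: scaleR_right_diff_distrib scaleR_sum_right sum_negf)
  have inner: "a \<bullet> s_inv j = - (1 / c) * ((if j \<in> V then 1 else 0) - (\<Sum>i\<in>V. z CARD('n) $ i * z CARD('n) $ j))" for j
    unfolding a_def by (simp add: inner_sum_left inner_vertex_inverse_vertex sum_subtractf)
  \<comment> \<open>As the last eigenvector is constant, \<open>a \<bullet> s_inv j\<close> depends
    on \<open>j\<close> only through membership in \<open>V\<close>.\<close>
  have "orthogonal a (s_inv j - s_inv j')" if "j \<in> V \<longleftrightarrow> j' \<in> V" for j j'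
    unfolding orthogonal_def inner_diff_right inner
    using that last_eigenvector_constant[of j j'] by simp
  then have "orthogonal a (x - y)" if "x \<in> s_inv ` A" "y \<in> s_inv ` A" "A = V \<or> A = -V" for x y A
    using that by blast
  then have "orthogonal a (x - y)" if "x \<in> face s_inv A" "y \<in> face s_inv A" "A = V \<or> A = -V" for x y A
    using that unfolding face_def by (blast intro: orthogonal_convex_hullI)
  then show "is_altitude s_inv V (- (1 / sum w (cut_set L V)) *\<^sub>R (\<Sum>i\<in>V. s i))"
    unfolding is_altitude_def c_def[symmetric] a_def[symmetric] using p q apq by blast
qed

text \<open>For disjoint sets only off-diagonal Laplacian entries occur, and these are the negated
  weights of the links joining the sets. Such links form the intersection of the two cut
  sets.\<close>

lemma inner_sum_vertices:
  assumes "V\<^sub>1 \<inter> V\<^sub>2 = {}" and "V\<^sub>1 \<noteq> UNIV"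
  shows "(\<Sum>i\<in>V\<^sub>1. s i) \<bullet> (\<Sum>j\<in>V\<^sub>2. s j) = - sum w (cut_set L V\<^sub>1 \<inter> cut_set L V\<^sub>2)"
proof -
  have "(\<Sum>i\<in>V\<^sub>1. s i) \<bullet> (\<Sum>j\<in>V\<^sub>2. s j) = (\<Sum>i\<in>V\<^sub>1. \<Sum>j\<in>V\<^sub>2. laplacian L w $ i $ j)"
    unfolding inner_sum_left unfolding inner_sum_right inner_vertices ..
  also have "\<dots> = (\<Sum>i\<in>V\<^sub>1. \<Sum>j\<in>V\<^sub>2. - link_weight L w i j)"
    using assms(1) by (intro sum.cong refl) (auto simp: laplacian_nth[OF weighted])
  finally show ?thesis
    using cut_set_Int_eq_iff_disjoint[OF connected assms(2), of V\<^sub>2] sum_links_between[OF assms(1), of w L]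
      assms(1)
    by (simp add: sum_negf)
qed

end

theorem mainTheorem5:
  fixes L :: "'n::finite set set" and w :: "'n set \<Rightarrow> real"
    and \<mu> :: "nat \<Rightarrow> real" and z :: "nat \<Rightarrow> real^'n"
    and e :: "'m::finite \<Rightarrow> nat"
    and V\<^sub>1 V\<^sub>2 :: "'n set"
  assumes "CARD('n) \<ge> 2"
    and "weighted_graph L w" and "connected_graph L"
    and "ordered_eigenbasis (laplacian L w) \<mu> z"
    and "bij_betw e (UNIV :: 'm set) {1..CARD('n) - 1}"
    and "V\<^sub>1 \<noteq> {}" and "V\<^sub>1 \<noteq> UNIV" and "V\<^sub>2 \<noteq> {}" and "V\<^sub>2 \<noteq> UNIV"
    and "V\<^sub>1 \<inter> V\<^sub>2 = {}"
  shows "centroid_vector (simplex_vertex e \<mu> z) V\<^sub>1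
             \<bullet> centroid_vector (simplex_vertex e \<mu> z) V\<^sub>2
           = - (sum w (cut_set L V\<^sub>1 \<inter> cut_set L V\<^sub>2) / (real (card V\<^sub>1) * real (card V\<^sub>2)))
       \<and> altitude (inverse_simplex_vertex e \<mu> z) V\<^sub>1
             \<bullet> altitude (inverse_simplex_vertex e \<mu> z) V\<^sub>2
           = - (sum w (cut_set L V\<^sub>1 \<inter> cut_set L V\<^sub>2)
                / (sum w (cut_set L V\<^sub>1) * sum w (cut_set L V\<^sub>2)))
       \<and> cut_set L V\<^sub>1 \<inter> cut_set L V\<^sub>2
           = {{i, j} | i j. {i, j} \<in> L \<and> i \<in> V\<^sub>1 \<and> j \<in> V\<^sub>2}"
proof -
  interpret graph_eigenbasis L w \<mu> z e
    using assms by unfold_locales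
  note inner = inner_sum_vertices[OF \<open>V\<^sub>1 \<inter> V\<^sub>2 = {}\<close> \<open>V\<^sub>1 \<noteq> UNIV\<close>]
  \<comment> \<open>Centroids and altitudes are both multiples of the same vertex sums. The two
    minus signs of the altitudes cancel, so both products keep the sign of
    \<open>inner\<close>.\<close>
  show ?thesis
    using assms cut_set_Int_eq_iff_disjoint[of L V\<^sub>1 V\<^sub>2]
    by (simp add: centroid_vector_def altitude_inverse_simplex inner)
qed

end
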